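(* Let $l\in\{1,\dots,n\}$. For sufficiently large $n,N$ and $\pi_{\max}\le\frac1{20}$, one has $$\tau_l \;\ge\; 0.4\cdot\frac{l-1}{n-1}\cdot\frac{1}{1.1^{\,l}}\cdot \mathsf{weight}\left(\pi,\left[0.7\,\frac{l-1}{n-1},\ \frac43\,\frac{l-1}{n-1}\right]\right).$$
   Context: $X$ is a finite domain with $|X|=N$, and $n$ is the number of training samples. $\pi=\{\pi_1,\dots,\pi_N\}$ is a list of $N$ prior probabilities (nonnegative, summing to 1), and $\pi_{\max}:=\max_{j\in[N]}\pi_j$. A random distribution $D$ on $X$ is generated as follows: for each $x\in X$ sample $p_x$ independently and uniformly from the list $\pi$, and set $D(x)=p_x/\sum_{x'\in X}p_{x'}$. Let $\bar\pi^N$ denote the resulting marginal distribution of $D(x)$ for a single $x$, i.e. $\bar\pi^N(\alpha)=\mathbb P[D(x)=\alpha]$. Define $$\tau_l := \frac{\mathbb E_{\alpha\sim\bar\pi^N}[\alpha^{l+1}(1-\alpha)^{n-l}]}{\mathbb E_{\alpha\sim\bar\pi^N}[\alpha^{l}(1-\alpha)^{n-l}]}.$$ For $\beta_1\le\beta_2$, $\mathsf{weight}(\pi,[\beta_1,\beta_2])$ is the expected fraction of the distribution $D$ contributed by frequencies in $[\beta_1,\beta_2]$: $$\mathsf{weight}(\pi,[\beta_1,\beta_2]):=\mathbb E\left[\sum_{x\in X}D(x)\cdot \mathbf 1\big(D(x)\in[\beta_1,\beta_2]\big)\right],$$ where the expectation is over the random generation of $D$ from $\pi$, i.e. over sampling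 each $p_x$, $x\in X$, independently and uniformly from the list $\pi$, followed by the normalization $D(x)=p_x/\sum_{x'\in X}p_{x'}$. *)

theory Defs
  imports "HOL-Probability.Probability"
begin

definition prior_list :: "nat \<Rightarrow> real list \<Rightarrow> bool" where
  "prior_list N pr \<longleftrightarrow> length pr = N \<and> (\<forall>q\<in>set pr. 0 \<le> q) \<and> sum_list pr = 1"

definition prior_max :: "real list \<Rightarrow> real" where
  "prior_max pr = Max (set pr)"

text \<open>Sampling goes through the index, so repeated entries count with multiplicity.\<close>

definition uniform_entry :: "real list \<Rightarrow> real pmf" where
  "uniform_entry pr = map_pmf (\<lambda>j. pr ! j) (pmf_of_set {..<length pr})"

definition normalized :: "'a set \<Rightarrow> ('a \<Rightarrow> real) \<Rightarrow> 'a \<Rightarrow> real" where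
  "normalized X p = (\<lambda>x. p x / (\<Sum>x'\<in>X. p x'))"

text \<open>
  If the prior list contains zeros, all sampled values may be 0. The quotient is 0/0 = 0 there,
  so \<open>D\<close> is identically 0 on this event; it then contributes nothing to \<open>weight\<close>, nor, for
  \<open>l \<ge> 1\<close>, to either expectation in \<open>tau\<close>.
\<close>

definition random_distribution :: "'a set \<Rightarrow> real list \<Rightarrow> ('a \<Rightarrow> real) pmf" where
  "random_distribution X pr = map_pmf (normalized X) (Pi_pmf X 0 (\<lambda>_. uniform_entry pr))"

definition marginal :: "'a set \<Rightarrow> real list \<Rightarrow> 'a \<Rightarrow> real pmf" where
  "marginal X pr x = map_pmf (\<lambda>D. D x) (random_distribution X pr)"

definition tau :: "real pmf \<Rightarrow> nat \<Rightarrow> nat \<Rightarrow> real" where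
  "tau Q n l =
     measure_pmf.expectation Q (\<lambda>\<alpha>. \<alpha> ^ (l + 1) * (1 - \<alpha>) ^ (n - l)) /
     measure_pmf.expectation Q (\<lambda>\<alpha>. \<alpha> ^ l * (1 - \<alpha>) ^ (n - l))"

definition weight :: "'a set \<Rightarrow> real list \<Rightarrow> real \<Rightarrow> real \<Rightarrow> real" where
  "weight X pr \<beta>1 \<beta>2 =
     measure_pmf.expectation (random_distribution X pr)
       (\<lambda>D. \<Sum>x\<in>X. D x * indicator {\<beta>1..\<beta>2} (D x))"

end

theory Submission
  imports Defs
begin

text \<open>
  By symmetry both expectations in \<open>tau\<close> may be summed over all points of \<open>X\<close>. With
  \<open>m = l - 1\<close>, \<open>k = n - l\<close> and \<open>v a = a ^ m * (1 - a) ^ k\<close>, this gives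
  \<open>tau = E (\<Sum>D\<^sup>2 v D) / E (\<Sum>D v D)\<close>; as \<open>\<Sum>D \<le> 1\<close>, only the size of \<open>v\<close> matters. It is
  unimodal with peak \<open>t = m / (m + k)\<close>, and the weight in the statement is located around \<open>t\<close>.
  If \<open>t \<le> 1/20\<close>, then \<open>v\<close> below \<open>0.7 t\<close> exceeds \<open>v\<close> on \<open>[0.7 t, 4 t / 3]\<close> by a factor of at
  most \<open>1.1 ^ m\<close>. If \<open>t > 1/20\<close>, then \<open>l\<close> is large and it suffices to beat frequencies below
  roughly \<open>1.1 ^ (-l)\<close>, where \<open>v\<close> is superexponentially small; the only danger are frequencies
  near 1, where \<open>v\<close> may vanish. These are handled by double counting: frequencies above \<open>1/2\<close>
  carry at most four times the weight of those in \<open>[1/3, 1/2]\<close>.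
\<close>

section \<open>Growth of the beta kernel below its peak\<close>

definition beta_kernel :: "nat \<Rightarrow> nat \<Rightarrow> real \<Rightarrow> real" where
  "beta_kernel m k a = a ^ m * (1 - a) ^ k"

text \<open>The quotient of \<open>1 - a\<close> by \<open>1 - b\<close> is \<open>1 + u\<close>
  with \<open>u = (b - a) / (1 - b)\<close>, and \<open>1 + u \<le> exp u\<close> for either sign of
  \<open>u\<close>.\<close>

lemma one_minus_power_le:
  fixes a b :: real
  assumes "a \<le> 1" "b < 1"
  shows "(1 - a) ^ k \<le> (1 - b) ^ k * exp (real k * ((b - a) / (1 - b)))"
proof -
  have "1 - a = (1 - b) * (1 + (b - a) / (1 - b))"
    using assms by (simp add: field_simps)
  also have "\<dots> \<le> (1 - b) * exp ((b - a) / (1 - b))"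
    using assms by (intro mult_left_mono exp_ge_add_one_self) auto
  finally have "(1 - a) ^ k \<le> ((1 - b) * exp ((b - a) / (1 - b))) ^ k"
    using assms by (intro power_mono) auto
  then show ?thesis
    by (simp only: power_mult_distrib exp_of_nat_mult)
qed

lemma beta_kernel_nonneg: "0 \<le> a \<Longrightarrow> a \<le> 1 \<Longrightarrow> 0 \<le> beta_kernel m k a"
  by (simp add: beta_kernel_def)

text \<open>Passing from \<open>b\<close> down to \<open>a\<close> costs \<open>a ^ m\<close> at
  least a factor \<open>exp (- m * (b - a) / b)\<close> and gains the other power at most
  \<open>exp (k * (b - a) / (1 - b))\<close>. The assumption \<open>peak\<close> amounts to
  \<open>k / (1 - b) \<le> m / b\<close>, so the loss dominates.\<close>

lemma beta_kernel_mono: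
  assumes "0 \<le> a" "a \<le> b" "0 < b" "b < 1" and peak: "b * (real m + real k) \<le> real m"
  shows "beta_kernel m k a \<le> beta_kernel m k b"
proof -
  have "real k * ((b - a) / (1 - b)) \<le> real m * ((b - a) / b)"
  proof -
    have "real k * b \<le> real m * (1 - b)" using peak by (simp add: algebra_simps)
    then have "real k / (1 - b) \<le> real m / b" using assms by (simp add: field_simps)
    from mult_right_mono[OF this, of "b - a"] assms show ?thesis by (simp add: field_simps)
  qed
  then have "exp (real k * ((b - a) / (1 - b))) \<le> exp (real m * ((b - a) / b))"
    by (simp only: exp_le_cancel_iff)
  then have k: "(1 - a) ^ k \<le> (1 - b) ^ k * exp (real m * ((b - a) / b))"
    using assms by (intro order_trans[OF one_minus_power_le mult_left_mono]) auto
  have "a = b * (1 + (a - b) / b)" using assms by (simp add: field_simps)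
  also have "\<dots> \<le> b * exp ((a - b) / b)"
    using assms by (intro mult_left_mono exp_ge_add_one_self) auto
  finally have "a ^ m \<le> (b * exp ((a - b) / b)) ^ m"
    using assms by (intro power_mono) auto
  then have m: "a ^ m \<le> b ^ m * exp (- (real m * ((b - a) / b)))"
    by (simp only: power_mult_distrib exp_of_nat_mult[symmetric] mult_minus_right[symmetric]
        minus_divide_left minus_diff_eq)
  have "a ^ m * (1 - a) ^ k \<le>
      (b ^ m * exp (- (real m * ((b - a) / b)))) * ((1 - b) ^ k * exp (real m * ((b - a) / b)))"
    using assms by (intro mult_mono m k) auto
  also have "\<dots> = b ^ m * (1 - b) ^ k"
    by (simp add: exp_minus)
  finally show ?thesis by (simp add: beta_kernel_def)
qed

text \<open>After the power of \<open>1 - a\<close> is bounded by an exponential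
  \<open>exp (m * y)\<close>, everything is an \<open>m\<close>-th power. It remains to show
  \<open>7/10 * exp y \<le> 11/10 * (b / t)\<close>, which no longer involves \<open>m\<close> and
  \<open>k\<close>.\<close>

lemma beta_kernel_near_peak:
  fixes t b :: real
  assumes t: "t * (real m + real k) = real m" "0 < t" "t \<le> 1 / 20"
    and b: "7 / 10 * t \<le> b" "b \<le> 4 / 3 * t"
  shows "beta_kernel m k (7 / 10 * t) \<le> (11 / 10) ^ m * beta_kernel m k b"
proof -
  \<comment> \<open>The factor 51/50 bounds \<open>(1 - t) / (1 - b)\<close>: since
    \<open>b \<le> 4/3 * t\<close> and \<open>t \<le> 1/20\<close>, this quotient is at most
    57/56.\<close>
  define y where "y = 51 / 50 * (b / t - 7 / 10)"
  have bt: "7 / 10 \<le> b / t" "b / t \<le> 4 / 3" using b t by (simp_all add: field_simps)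
  then have y: "0 \<le> y" "y \<le> 1" by (auto simp: y_def)
  have b1: "b < 1" "0 < b" using b t by auto
  have kt: "real k = real m * ((1 - t) / t)" using t by (simp add: field_simps)
  have "(1 - t) / (1 - b) \<le> 51 / 50" using b t b1 by (simp add: field_simps)
  then have "real m * ((b / t - 7 / 10) * ((1 - t) / (1 - b))) \<le> real m * ((b / t - 7 / 10) * (51 / 50))"
    using bt by (intro mult_left_mono) auto
  moreover have "real k * ((b - 7 / 10 * t) / (1 - b)) = real m * ((b / t - 7 / 10) * ((1 - t) / (1 - b)))"
  proof -
    have "b - 7 / 10 * t = t * (b / t - 7 / 10)" using t by (simp add: field_simps)
    then show ?thesis unfolding kt using t by (simp del: right_diff_distrib_numeral)
  qed
  moreover have "(b / t - 7 / 10) * (51 / 50) = y" by (simp add: y_def)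
  ultimately have "real k * ((b - 7 / 10 * t) / (1 - b)) \<le> real m * y"
    by (simp only:)
  then have "exp (real k * ((b - 7 / 10 * t) / (1 - b))) \<le> exp (real m * y)"
    by (simp only: exp_le_cancel_iff)
  then have k: "(1 - 7 / 10 * t) ^ k \<le> (1 - b) ^ k * exp (real m * y)"
    using t b1 by (intro order_trans[OF one_minus_power_le mult_left_mono]) auto
  have "7 / 10 * exp y \<le> 11 / 10 * (b / t)"
  proof -
    define u where "u = b / t"
    have u: "7 / 10 \<le> u" "u \<le> 4 / 3" using bt by (simp_all add: u_def)
    \<comment> \<open>With \<open>exp y \<le> 1 + y + y^2\<close> the claim is quadratic in
      \<open>u\<close>. This product bounds \<open>u * u\<close> by its chord over the range of
      \<open>u\<close>, which leaves a linear inequality.\<close>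
    have "0 \<le> (u - 7 / 10) * (4 / 3 - u)"
      using u by (intro mult_nonneg_nonneg) auto
    also have "\<dots> = 61 / 30 * u - 14 / 15 - u * u"
      by (simp add: field_simps)
    finally have "u * u \<le> 61 / 30 * u - 14 / 15" by simp
    moreover have "7 / 10 * (1 + y + y\<^sup>2) = 18207 / 25000 * (u * u) - 305592 / 1000000 * u + 5570572 / 10000000"
      by (simp add: y_def u_def[symmetric] power2_eq_square field_simps)
    ultimately have "7 / 10 * (1 + y + y\<^sup>2) \<le> 11 / 10 * u"
      using u(2) by linarith
    then have "7 / 10 * (1 + y + y\<^sup>2) \<le> 11 / 10 * (b / t)"
      by (simp only: u_def)
    then show ?thesis
      using mult_left_mono[OF exp_bound[OF y], of "7 / 10"] by linarith
  qed
  then have "7 / 10 * t * exp y \<le> 11 / 10 * b"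
    using t by (simp add: field_simps)
  then have m: "(7 / 10 * t * exp y) ^ m \<le> (11 / 10 * b) ^ m"
    using t by (intro power_mono) auto
  have "(7 / 10 * t) ^ m * (1 - 7 / 10 * t) ^ k \<le> (7 / 10 * t) ^ m * ((1 - b) ^ k * exp (real m * y))"
    using t by (intro mult_left_mono k) auto
  also have "\<dots> = (7 / 10 * t * exp y) ^ m * (1 - b) ^ k"
    by (simp only: power_mult_distrib exp_of_nat_mult) (simp only: mult_ac)
  also have "\<dots> \<le> (11 / 10 * b) ^ m * (1 - b) ^ k"
    using b1 by (intro mult_right_mono m) auto
  also have "\<dots> = (11 / 10) ^ m * (b ^ m * (1 - b) ^ k)"
    by (simp only: power_mult_distrib mult_ac)
  finally show ?thesis by (simp add: beta_kernel_def)
qed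

section \<open>Lower bounds for ratios of kernel sums\<close>

text \<open>
  Points below \<open>s\<close> contribute at most \<open>V * \<Sum>d\<close> to the denominator, and points above \<open>s\<close> at most
  \<open>1 / s\<close> times the numerator.
\<close>

lemma weighted_mean_ge:
  fixes d :: "'b \<Rightarrow> real" and v :: "real \<Rightarrow> real"
  defines "A \<equiv> \<lambda>P. \<Sum>p\<in>P. d p * (d p * v (d p))"
    and "B \<equiv> \<lambda>P. \<Sum>p\<in>P. d p * v (d p)"
  assumes P: "finite P" and d: "\<And>p. p \<in> P \<Longrightarrow> 0 \<le> d p \<and> d p \<le> 1"
    and v: "\<And>a. 0 \<le> a \<Longrightarrow> a \<le> 1 \<Longrightarrow> 0 \<le> v a"
    and sum: "sum d P \<le> C"
    and s: "0 < s" and V: "0 \<le> V" "\<And>a. 0 \<le> a \<Longrightarrow> a < s \<Longrightarrow> v a \<le> V"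
    and W: "0 \<le> W" "W \<le> 1" and kap: "0 < kap" "kap * C * W \<le> A P" and C: "0 < C"
    and c: "0 \<le> c" "c * V \<le> (1 - c / s) * kap"
  shows "c * W \<le> A P / B P"
proof -
  have "B P \<le> (\<Sum>p\<in>P. V * d p + d p * (d p * v (d p)) / s)"
    unfolding B_def
  proof (rule sum_mono)
    fix p assume p: "p \<in> P"
    have vp: "0 \<le> v (d p)" using d[OF p] v by auto
    show "d p * v (d p) \<le> V * d p + d p * (d p * v (d p)) / s"
    proof (cases "d p < s")
      case True
      then have "d p * v (d p) \<le> d p * V" using d[OF p] V(2) by (intro mult_left_mono) auto
      moreover have "0 \<le> d p * (d p * v (d p)) / s" using d[OF p] vp s by simp
      ultimately show ?thesis by (simp add: mult.commute)
    next
      case False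
      then have "s * (d p * v (d p)) \<le> d p * (d p * v (d p))"
        using d[OF p] vp by (intro mult_right_mono) auto
      then have "d p * v (d p) \<le> d p * (d p * v (d p)) / s" using s by (simp add: field_simps)
      moreover have "0 \<le> V * d p" using V d[OF p] by simp
      ultimately show ?thesis by linarith
    qed
  qed
  also have "\<dots> = V * sum d P + A P / s"
    by (simp add: A_def sum.distrib sum_distrib_left sum_divide_distrib)
  also have "\<dots> \<le> V * C + A P / s"
    using sum V by (simp add: mult_left_mono)
  finally have B: "B P \<le> V * C + A P / s" .
  have AB: "A P \<le> B P"
    unfolding A_def B_def using d v by (intro sum_mono mult_left_le_one_le) auto
  have A0: "0 \<le> A P" unfolding A_def using d v by (intro sum_nonneg mult_nonneg_nonneg) auto
  show ?thesis
  proof (cases "B P = 0")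
    \<comment> \<open>Division by zero makes the quotient 0 here, so \<open>W = 0\<close> is needed;
      it follows from \<open>A P \<le> B P\<close>.\<close>
    case True
    then have "kap * C * W \<le> 0" using kap AB by simp
    then have "W = 0" using kap C W
      by (metis mult_pos_pos mult_le_0_iff not_less order_antisym)
    then show ?thesis using True by simp
  next
    case False
    then have B0: "0 < B P" using A0 AB by linarith
    have "c * W * B P \<le> c * W * (V * C + A P / s)"
      using c W by (intro mult_left_mono B) auto
    also have "\<dots> = (c * V) * (C * W) + (c / s) * (W * A P)"
      by (simp add: algebra_simps)
    \<comment> \<open>The bound \<open>W \<le> 1\<close> drops \<open>W\<close> in front of
      \<open>A P\<close>. The shares \<open>1 - c / s\<close> and \<open>c / s\<close> then add up
      to one copy of \<open>A P\<close>.\<close>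
    also have "\<dots> \<le> ((1 - c / s) * kap) * (C * W) + (c / s) * (1 * A P)"
      using c W C s A0 by (intro add_mono mult_right_mono mult_left_mono) auto
    also have "\<dots> = (1 - c / s) * (kap * C * W) + (c / s) * A P"
      by (simp add: algebra_simps)
    also have "\<dots> \<le> (1 - c / s) * A P + (c / s) * A P"
    proof -
      have "0 \<le> (1 - c / s) * kap" using c V by (meson mult_nonneg_nonneg order_trans)
      then have "0 \<le> 1 - c / s" using kap by (simp add: zero_le_mult_iff)
      then show ?thesis using kap by (intro add_mono mult_left_mono order_refl)
    qed
    also have "\<dots> = A P" by (simp add: algebra_simps)
    finally show ?thesis using B0 by (simp add: field_simps)
  qed
qed

text \<open>The cut \<open>s\<close> is the lower end of the window and \<open>V\<close> the kernel
  there. Inside the window the kernel is at least \<open>V / 1.1 ^ m\<close> and the extra factor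
  \<open>d p\<close> at least \<open>s\<close>, which gives \<open>kap\<close>.\<close>

lemma beta_mean_ge_small_peak:
  fixes d :: "'b \<Rightarrow> real" and t :: real
  assumes P: "finite P" and d: "\<And>p. p \<in> P \<Longrightarrow> 0 \<le> d p \<and> d p \<le> 1"
    and sum: "sum d P \<le> C" and C: "0 < C"
    and W: "W = (\<Sum>p\<in>P. d p * indicator {7 / 10 * t..4 / 3 * t} (d p)) / C"
    and t: "t * (real m + real k) = real m" "0 < t" "t \<le> 1 / 20" and m: "1 \<le> m"
  shows "2 / 5 * t / (11 / 10) ^ Suc m * W \<le>
    (\<Sum>p\<in>P. d p * (d p * beta_kernel m k (d p))) / (\<Sum>p\<in>P. d p * beta_kernel m k (d p))"
proof (rule weighted_mean_ge[OF P d beta_kernel_nonneg sum, where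
      s = "7 / 10 * t" and V = "beta_kernel m k (7 / 10 * t)" and
      kap = "7 / 10 * t * (beta_kernel m k (7 / 10 * t) / (11 / 10) ^ m)"])
  let ?V = "beta_kernel m k (7 / 10 * t)"
  let ?I = "{7 / 10 * t..4 / 3 * t}"
  show Vpos: "0 \<le> ?V" using t by (intro beta_kernel_nonneg) auto
  have V0: "0 < ?V" using t by (auto simp: beta_kernel_def)
  show "0 < 7 / 10 * t" using t by simp
  show "beta_kernel m k a \<le> ?V" if "0 \<le> a" "a < 7 / 10 * t" for a
    using that t by (intro beta_kernel_mono) (auto simp: algebra_simps)
  show "0 \<le> W" unfolding W using d C by (auto intro!: divide_nonneg_pos sum_nonneg)
  have "(\<Sum>p\<in>P. d p * indicator ?I (d p)) \<le> sum d P"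
    using d by (intro sum_mono) (auto simp: indicator_def)
  then show "W \<le> 1" unfolding W using sum C by simp
  show "0 < 7 / 10 * t * (?V / (11 / 10) ^ m)" using V0 t by simp
  show "0 < C" by fact
  have "7 / 10 * t * (?V / (11 / 10) ^ m) * C * W =
      (7 / 10 * t * (?V / (11 / 10) ^ m)) * (\<Sum>p\<in>P. d p * indicator ?I (d p))"
    unfolding W using C by simp
  also have "\<dots> = (\<Sum>p\<in>P. (7 / 10 * t * (?V / (11 / 10) ^ m)) * (d p * indicator ?I (d p)))"
    by (rule sum_distrib_left)
  also have "\<dots> \<le> (\<Sum>p\<in>P. d p * (d p * beta_kernel m k (d p)))"
  proof (rule sum_mono)
    fix p assume p: "p \<in> P"
    show "(7 / 10 * t * (?V / (11 / 10) ^ m)) * (d p * indicator ?I (d p)) \<le>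
        d p * (d p * beta_kernel m k (d p))"
    proof (cases "d p \<in> ?I")
      case True
      then have "?V \<le> (11 / 10) ^ m * beta_kernel m k (d p)"
        using t by (intro beta_kernel_near_peak) auto
      then have "?V / (11 / 10) ^ m \<le> beta_kernel m k (d p)"
        by (simp add: field_simps)
      then have "7 / 10 * t * (?V / (11 / 10) ^ m) \<le> d p * beta_kernel m k (d p)"
        using True t Vpos by (intro mult_mono) auto
      then have "d p * (7 / 10 * t * (?V / (11 / 10) ^ m)) \<le> d p * (d p * beta_kernel m k (d p))"
        using d[OF p] by (intro mult_left_mono) auto
      then show ?thesis using True by (simp add: mult.commute)
    next
      case False
      then show ?thesis using d[OF p] by (simp add: beta_kernel_nonneg)
    qed
  qed
  finally show "7 / 10 * t * (?V / (11 / 10) ^ m) * C * W \<le>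
      (\<Sum>p\<in>P. d p * (d p * beta_kernel m k (d p)))" .
  show "0 \<le> 2 / 5 * t / (11 / 10) ^ Suc m" using t by simp
  \<comment> \<open>Divided by \<open>t * V / q\<close>, the condition on \<open>c\<close> reads
    \<open>4/11 \<le> (1 - 40/77 / q) * 7/10\<close>. It fails at \<open>q = 1\<close> but holds
    from \<open>q = 11/10\<close> on, hence \<open>1 \<le> m\<close>.\<close>
  define q where "q = (11 / 10 :: real) ^ m"
  have "(11 / 10) ^ 1 \<le> q" unfolding q_def using m by (intro power_increasing) auto
  then have q: "11 / 10 \<le> q" by simp
  have qS: "(11 / 10 :: real) ^ Suc m = 11 / 10 * q" by (simp add: q_def)
  have "4 / 11 \<le> (1 - 40 / 77 / q) * (7 / 10)"
    using q by (simp add: field_simps)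
  then have "(t * ?V / q) * (4 / 11) \<le> (t * ?V / q) * ((1 - 40 / 77 / q) * (7 / 10))"
    using t Vpos q by (intro mult_left_mono) auto
  moreover have "(t * ?V / q) * (4 / 11) = 2 / 5 * t / (11 / 10 * q) * ?V"
    using q by (simp add: field_simps)
  moreover have "2 / 5 * t / (11 / 10 * q) / (7 / 10 * t) = 40 / 77 / q"
    using q t by (simp add: field_simps)
  moreover have "e * (r * t * (?V / q)) = (t * ?V / q) * (e * r)" for e r
    by (simp add: mult_ac)
  ultimately show "2 / 5 * t / (11 / 10) ^ Suc m * ?V \<le>
      (1 - 2 / 5 * t / (11 / 10) ^ Suc m / (7 / 10 * t)) * (7 / 10 * t * (?V / (11 / 10) ^ m))"
    unfolding qS q_def[symmetric] by (simp only:)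
qed auto

text \<open>
  Since \<open>k \<le> 19 m\<close>, the kernel is at least \<open>z ^ m\<close> on \<open>[7/200, 1/2]\<close> with
  \<open>z = 7/200 * (1/2) ^ 19\<close>; the assumption \<open>large\<close> makes \<open>(2 * c) ^ m\<close> negligible against this.
\<close>

lemma beta_mean_ge_large_peak:
  fixes d :: "'b \<Rightarrow> real" and t :: real
  assumes P: "finite P" and d: "\<And>p. p \<in> P \<Longrightarrow> 0 \<le> d p \<and> d p \<le> 1"
    and sum: "sum d P \<le> C" and C: "0 < C"
    and W: "W = (\<Sum>p\<in>P. d p * indicator {7 / 10 * t..4 / 3 * t} (d p)) / C"
    and t: "t * (real m + real k) = real m" "1 / 20 \<le> t" "t \<le> 1" and m: "1 \<le> m"
    and half: "(\<Sum>p\<in>P. d p * indicator {1 / 2<..} (d p)) \<le>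
      4 * (\<Sum>p\<in>P. d p * indicator {1 / 3..1 / 2} (d p))"
    and large: "2000 * 2 ^ 19 * 1000 \<le> (11 / 10 :: real) ^ Suc m"
  shows "2 / 5 * t / (11 / 10) ^ Suc m * W \<le>
    (\<Sum>p\<in>P. d p * (d p * beta_kernel m k (d p))) / (\<Sum>p\<in>P. d p * beta_kernel m k (d p))"
proof -
  define c where "c = 2 / 5 * t / (11 / 10) ^ Suc m"
  define z where "z = (7 / 200) * (1 / 2 :: real) ^ 19"
  let ?I = "{7 / 10 * t..4 / 3 * t}"
  let ?J = "{7 / 200..1 / 2 :: real}"
  have z: "0 < z" by (simp add: z_def)
  have c0: "0 < c" unfolding c_def using t by simp
  have c1: "c \<le> 1 / (11 / 10) ^ Suc m"
    unfolding c_def using t by (intro divide_right_mono) auto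
  also have "\<dots> \<le> 1 / (2000 * 2 ^ 19 * 1000)"
    using large by (intro divide_left_mono) auto
  also have "\<dots> \<le> 7 / 4000 * z" by (simp add: z_def power_divide)
  finally have cz: "2 * c \<le> 7 / 2000 * z" by simp
  have c_le_1: "c \<le> 1"
  proof -
    have "z \<le> 1" by (simp add: z_def power_divide)
    then show ?thesis using cz by linarith
  qed
  have k: "k \<le> 19 * m"
  proof -
    have "(1 / 20) * (real m + real k) \<le> real m"
      using t mult_right_mono[of "1 / 20" t "real m + real k"] by simp
    then have "real k \<le> real (19 * m)" by simp
    then show ?thesis by (simp only: of_nat_le_iff)
  qed
  have kern: "z ^ m \<le> beta_kernel m k a" if "a \<in> ?J" for a
  proof -
    have "z ^ m = (7 / 200) ^ m * (1 / 2) ^ (19 * m)"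
      by (simp only: z_def power_mult_distrib power_mult)
    also have "\<dots> \<le> (7 / 200) ^ m * (1 / 2) ^ k"
      using k by (intro mult_left_mono power_decreasing) auto
    also have "\<dots> \<le> a ^ m * (1 - a) ^ k"
      using that by (intro mult_mono power_mono) auto
    finally show ?thesis by (simp add: beta_kernel_def)
  qed
  \<comment> \<open>The window starts no lower than \<open>7/10 * 1/20 = 7/200\<close>, so it leaves
    \<open>?J\<close> only above 1/2. That part is charged by \<open>half\<close> to
    \<open>[1/3, 1/2]\<close>, which lies in \<open>?J\<close>; in total a factor 5 is lost.\<close>
  have "(\<Sum>p\<in>P. d p * indicator ?I (d p)) \<le>
      (\<Sum>p\<in>P. d p * indicator ?J (d p) + d p * indicator {1 / 2<..} (d p))"
    using d t by (intro sum_mono) (auto simp: indicator_def)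
  also have "\<dots> \<le> (\<Sum>p\<in>P. d p * indicator ?J (d p)) + 4 * (\<Sum>p\<in>P. d p * indicator {1 / 3..1 / 2} (d p))"
    using half by (simp add: sum.distrib)
  also have "\<dots> \<le> (\<Sum>p\<in>P. d p * indicator ?J (d p)) + 4 * (\<Sum>p\<in>P. d p * indicator ?J (d p))"
    using d by (intro add_mono mult_left_mono sum_mono) (auto simp: indicator_def)
  finally have IJ: "(\<Sum>p\<in>P. d p * indicator ?I (d p)) \<le> 5 * (\<Sum>p\<in>P. d p * indicator ?J (d p))"
    by simp
  have "c * W \<le> (\<Sum>p\<in>P. d p * (d p * beta_kernel m k (d p))) / (\<Sum>p\<in>P. d p * beta_kernel m k (d p))"
  \<comment> \<open>The choice \<open>s = 2 * c\<close> makes \<open>1 - c / s\<close> equal to 1/2,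
    and \<open>kap\<close> is \<open>7/200 * z ^ m\<close> divided by the lost factor 5. The
    condition left is \<open>c * (2 * c) ^ m \<le> 7/2000 * z ^ m\<close>.\<close>
  proof (rule weighted_mean_ge[OF P d beta_kernel_nonneg sum, where
        s = "2 * c" and V = "(2 * c) ^ m" and kap = "7 / 1000 * z ^ m"])
    show "0 < 2 * c" "0 \<le> (2 * c) ^ m" "0 \<le> c" "0 < C" "0 < 7 / 1000 * z ^ m"
      using c0 C z by auto
    show "beta_kernel m k a \<le> (2 * c) ^ m" if "0 \<le> a" "a < 2 * c" for a
    proof -
      have "2 * c \<le> 1" using cz by (simp add: z_def power_divide)
      then have "a ^ m * (1 - a) ^ k \<le> (2 * c) ^ m * 1"
        using that by (intro mult_mono power_mono power_le_one) auto
      then show ?thesis by (simp add: beta_kernel_def)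
    qed
    show "0 \<le> W" unfolding W using d C by (auto intro!: divide_nonneg_pos sum_nonneg)
    have "(\<Sum>p\<in>P. d p * indicator ?I (d p)) \<le> sum d P"
      using d by (intro sum_mono) (auto simp: indicator_def)
    then show "W \<le> 1" unfolding W using sum C by simp
    have "7 / 1000 * z ^ m * C * W = 7 / 1000 * z ^ m * (\<Sum>p\<in>P. d p * indicator ?I (d p))"
      unfolding W using C by simp
    also have "\<dots> \<le> 7 / 1000 * z ^ m * (5 * (\<Sum>p\<in>P. d p * indicator ?J (d p)))"
      using z by (intro mult_left_mono IJ) auto
    also have "\<dots> = (\<Sum>p\<in>P. 7 / 200 * z ^ m * (d p * indicator ?J (d p)))"
      by (simp add: sum_distrib_left mult_ac)
    also have "\<dots> \<le> (\<Sum>p\<in>P. d p * (d p * beta_kernel m k (d p)))"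
    proof (rule sum_mono)
      fix p assume p: "p \<in> P"
      show "7 / 200 * z ^ m * (d p * indicator ?J (d p)) \<le> d p * (d p * beta_kernel m k (d p))"
      proof (cases "d p \<in> ?J")
        case True
        then have "7 / 200 * z ^ m \<le> d p * beta_kernel m k (d p)"
          using kern[OF True] z by (intro mult_mono) auto
        then have "d p * (7 / 200 * z ^ m) \<le> d p * (d p * beta_kernel m k (d p))"
          using d[OF p] by (intro mult_left_mono) auto
        then show ?thesis using True by (simp add: mult.commute)
      next
        case False
        then show ?thesis using d[OF p] by (simp add: beta_kernel_nonneg)
      qed
    qed
    finally show "7 / 1000 * z ^ m * C * W \<le> (\<Sum>p\<in>P. d p * (d p * beta_kernel m k (d p)))" .
    have "c * (2 * c) ^ m \<le> 1 * (7 / 2000 * z) ^ m"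
      using c0 by (intro mult_mono[OF c_le_1 power_mono[OF cz]]) auto
    also have "\<dots> \<le> (7 / 2000) * z ^ m"
      using m z power_decreasing[of 1 m "7 / 2000 :: real"]
      by (simp only: power_mult_distrib mult_1) (intro mult_right_mono; simp)
    finally show "c * (2 * c) ^ m \<le> (1 - c / (2 * c)) * (7 / 1000 * z ^ m)"
      using c0 by simp
  qed auto
  then show ?thesis by (simp add: c_def)
qed

section \<open>Reduction to averages over a finite set of index maps\<close>

definition entry :: "real list \<Rightarrow> nat \<Rightarrow> real" where
  "entry pr j = (if j < length pr then pr ! j else 0)"

text \<open>
  Outside \<open>X\<close> the index is the out-of-range value \<open>length pr\<close>, whose entry is the default 0.
\<close>

definition index_maps :: "'a set \<Rightarrow> real list \<Rightarrow> ('a \<Rightarrow> nat) set" where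
  "index_maps X pr = PiE_dflt X (length pr) (\<lambda>_. {..<length pr})"

definition freq :: "'a set \<Rightarrow> real list \<Rightarrow> ('a \<Rightarrow> nat) \<Rightarrow> 'a \<Rightarrow> real" where
  "freq X pr w = normalized X (entry pr \<circ> w)"

lemma finite_index_maps: "finite X \<Longrightarrow> finite (index_maps X pr)"
  unfolding index_maps_def by (rule finite_PiE_dflt) auto

lemma index_maps_nonempty: "pr \<noteq> [] \<Longrightarrow> index_maps X pr \<noteq> {}"
  by (auto simp: index_maps_def lessThan_empty_iff)

text \<open>Drawing indices instead of values keeps equal entries of the list apart. The sampling is
  then uniform on a finite set, and every expectation is an average.\<close>

lemma random_distribution_eq:
  assumes "finite X" "pr \<noteq> []"
  shows "random_distribution X pr = map_pmf (freq X pr) (pmf_of_set (index_maps X pr))"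
proof -
  have "uniform_entry pr = map_pmf (entry pr) (pmf_of_set {..<length pr})"
    unfolding uniform_entry_def using assms
    by (intro map_pmf_cong refl) (auto simp: entry_def set_pmf_of_set lessThan_empty_iff)
  then have "Pi_pmf X 0 (\<lambda>_. uniform_entry pr) =
      map_pmf (\<lambda>h. entry pr \<circ> h) (Pi_pmf X (length pr) (\<lambda>_. pmf_of_set {..<length pr}))"
    using assms by (simp add: Pi_pmf_map[where dflt = "length pr"] entry_def)
  also have "Pi_pmf X (length pr) (\<lambda>_. pmf_of_set {..<length pr}) = pmf_of_set (index_maps X pr)"
    unfolding index_maps_def using assms by (intro Pi_pmf_of_set) (auto simp: lessThan_empty_iff)
  finally show ?thesis
    by (simp add: random_distribution_def freq_def[abs_def] map_pmf_comp o_def)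
qed

lemma expectation_random_distribution:
  fixes f :: "('a \<Rightarrow> real) \<Rightarrow> real"
  assumes "finite X" "pr \<noteq> []"
  shows "measure_pmf.expectation (random_distribution X pr) f =
    (\<Sum>w\<in>index_maps X pr. f (freq X pr w)) / card (index_maps X pr)"
  using assms
  by (simp add: random_distribution_eq integral_pmf_of_set finite_index_maps index_maps_nonempty)

text \<open>Composition with the transposition of \<open>x\<close> and \<open>y\<close> permutes the
  index maps and leaves the normalizing sum unchanged.\<close>

lemma sum_freq_symmetric:
  assumes X: "finite X" "x \<in> X" "y \<in> X"
  shows "(\<Sum>w\<in>index_maps X pr. f (freq X pr w x)) = (\<Sum>w\<in>index_maps X pr. f (freq X pr w y))"
proof -
  let ?T = "\<lambda>w. w \<circ> Transposition.transpose x y"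
  have T: "?T w \<in> index_maps X pr" if "w \<in> index_maps X pr" for w
    using that X by (auto simp: index_maps_def PiE_dflt_def Transposition.transpose_def)
  have transpose_mem: "Transposition.transpose x y z \<in> X" if "z \<in> X" for z
    using that X by (simp add: Transposition.transpose_def)
  have F: "freq X pr (?T w) y = freq X pr w x" for w
  proof -
    have "(\<Sum>x'\<in>X. entry pr (w (Transposition.transpose x y x'))) = (\<Sum>x'\<in>X. entry pr (w x'))"
      by (rule sum.reindex_bij_witness[of _ "Transposition.transpose x y" "Transposition.transpose x y"])
         (use X in \<open>auto simp: transpose_mem\<close>)
    then show ?thesis by (simp add: freq_def normalized_def)
  qed
  show ?thesis
    by (rule sum.reindex_bij_witness[of _ ?T ?T]) (auto simp: T F comp_assoc)
qed

text \<open>Averaging over all points as well lets \<open>tau\<close> be written with sums over one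
  index set; the common denominator cancels in the quotient.\<close>

lemma expectation_marginal:
  fixes f :: "real \<Rightarrow> real"
  assumes "finite X" "pr \<noteq> []" "x \<in> X"
  shows "measure_pmf.expectation (marginal X pr x) f =
    (\<Sum>(w, y)\<in>index_maps X pr \<times> X. f (freq X pr w y)) / (card X * card (index_maps X pr))"
proof -
  have "measure_pmf.expectation (marginal X pr x) f =
      (\<Sum>w\<in>index_maps X pr. f (freq X pr w x)) / card (index_maps X pr)"
    using assms expectation_random_distribution[of X pr "\<lambda>D. f (D x)"]
    by (simp add: marginal_def)
  moreover have "(\<Sum>(w, y)\<in>index_maps X pr \<times> X. f (freq X pr w y)) =
      card X * (\<Sum>w\<in>index_maps X pr. f (freq X pr w x))"
  proof -
    have "(\<Sum>(w, y)\<in>index_maps X pr \<times> X. f (freq X pr w y)) =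
        (\<Sum>y\<in>X. \<Sum>w\<in>index_maps X pr. f (freq X pr w y))"
      by (simp add: sum.cartesian_product[symmetric] sum.swap[of _ X])
    also have "\<dots> = (\<Sum>y\<in>X. \<Sum>w\<in>index_maps X pr. f (freq X pr w x))"
      using assms by (intro sum.cong refl sum_freq_symmetric) auto
    finally show ?thesis by simp
  qed
  moreover have "card X \<noteq> 0" using assms by auto
  ultimately show ?thesis by simp
qed

section \<open>Bounds on frequencies and the weight of dominant points\<close>

lemma entry_nonneg: "\<forall>q\<in>set pr. 0 \<le> q \<Longrightarrow> 0 \<le> entry pr j"
  by (simp add: entry_def)

lemma freq_bounds:
  assumes "finite X" "\<forall>q\<in>set pr. 0 \<le> q" "x \<in> X"
  shows "0 \<le> freq X pr w x" "freq X pr w x \<le> 1"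
proof -
  have "entry pr (w x) \<le> (\<Sum>x'\<in>X. entry pr (w x'))"
    using assms by (intro member_le_sum) (auto simp: entry_nonneg)
  then show "0 \<le> freq X pr w x" "freq X pr w x \<le> 1"
    using assms entry_nonneg[OF assms(2), of "w x"] sum_nonneg[of X "\<lambda>x'. entry pr (w x')"]
    by (auto simp: freq_def normalized_def entry_nonneg divide_le_eq_1)
qed

text \<open>The sum is 1 unless all sampled entries vanish, when every frequency is 0 by division by
  zero.\<close>

lemma sum_freq_le_1: "(\<Sum>x\<in>X. freq X pr w x) \<le> 1"
  by (cases "(\<Sum>x\<in>X. entry pr (w x)) = 0")
     (simp_all add: freq_def normalized_def flip: sum_divide_distrib)

text \<open>If \<open>q\<close> is the dominant entry and \<open>R\<close> the total away from
  \<open>x\<close> and \<open>y\<close>, dominance gives \<open>R < q\<close>. The new frequency is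
  \<open>q / (2 * q + R)\<close>, and a third point with the index of \<open>x\<close> would already
  contribute \<open>q\<close> to \<open>R\<close>.\<close>

lemma freq_duplicate_dominant:
  assumes X: "finite X" and pr: "\<forall>q\<in>set pr. 0 \<le> q"
    and x: "x \<in> X" "1 / 2 < freq X pr w x" and y: "y \<in> X" "y \<noteq> x"
  defines "w' \<equiv> w(y := w x)"
  shows "1 / 3 \<le> freq X pr w' x" "freq X pr w' x \<le> 1 / 2"
    and "\<And>y'. y' \<in> X \<Longrightarrow> y' \<noteq> x \<Longrightarrow> w' y' = w' x \<Longrightarrow> y' = y"
proof -
  define q where "q = entry pr (w x)"
  define R where "R = (\<Sum>z\<in>X - {x, y}. entry pr (w z))"
  have e0: "0 \<le> entry pr j" for j using pr by (rule entry_nonneg)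
  have split: "(\<Sum>z\<in>X. entry pr (u z)) = entry pr (u x) + entry pr (u y) + (\<Sum>z\<in>X - {x, y}. entry pr (u z))" for u
  proof -
    have "X = insert x (insert y (X - {x, y}))" using x y by auto
    then have "(\<Sum>z\<in>X. entry pr (u z)) = (\<Sum>z\<in>insert x (insert y (X - {x, y})). entry pr (u z))"
      by simp
    also have "\<dots> = entry pr (u x) + (entry pr (u y) + (\<Sum>z\<in>X - {x, y}. entry pr (u z)))"
      using X y by (subst sum.insert; simp)+
    finally show ?thesis by simp
  qed
  have R0: "0 \<le> R" unfolding R_def by (intro sum_nonneg e0)
  have f: "1 / 2 < q / (q + entry pr (w y) + R)"
    using x(2) by (simp add: freq_def normalized_def split q_def R_def)
  have q0: "0 \<le> q" by (simp add: q_def e0)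
  with f have qpos: "0 < q" by (cases "q = 0") auto
  then have R1: "R < q"
    using f R0 e0[of "w y"] by (simp add: field_simps)
  have w'x: "w' x = w x" "w' y = w x" using y by (auto simp: w'_def)
  have "(\<Sum>z\<in>X - {x, y}. entry pr (w' z)) = R"
    unfolding R_def w'_def by (intro sum.cong) auto
  then have sum': "(\<Sum>z\<in>X. entry pr (w' z)) = 2 * q + R"
    by (simp add: split w'x q_def)
  then have fr: "freq X pr w' x = q / (2 * q + R)"
    by (simp add: freq_def normalized_def w'x q_def)
  show "1 / 3 \<le> freq X pr w' x" "freq X pr w' x \<le> 1 / 2"
    unfolding fr using qpos R0 R1 by (simp_all add: field_simps)
  show "y' = y" if y': "y' \<in> X" "y' \<noteq> x" "w' y' = w' x" for y'
  proof (rule ccontr)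
    assume ne: "y' \<noteq> y"
    have "entry pr (w y') \<le> R"
      unfolding R_def using X y' ne by (intro member_le_sum) (auto simp: e0)
    moreover have "entry pr (w y') = q" using y' ne w'x by (simp add: w'_def q_def)
    ultimately show False using R1 by simp
  qed
qed

text \<open>
  Double counting: overwriting the index of a second point \<open>y\<close> by that of a dominant point \<open>x\<close>
  loses only the old index of \<open>y\<close>, since \<open>y\<close> is the only other point with the index of \<open>x\<close>
  afterwards.
\<close>

lemma card_dominant_le:
  assumes X: "finite X" and pr: "\<forall>q\<in>set pr. 0 \<le> q" "length pr = card X"
  defines "S \<equiv> \<lambda>I. {(w, x) \<in> index_maps X pr \<times> X. freq X pr w x \<in> I}"
  shows "card (S {1 / 2<..}) * (card X - 1) \<le> card (S {1 / 3..1 / 2}) * card X"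
proof -
  let ?A = "Sigma (S {1 / 2<..}) (\<lambda>(w, x). X - {x})"
  \<comment> \<open>The second component stores the overwritten index; its range is
    \<open>{..<card X}\<close> because \<open>length pr = card X\<close>.\<close>
  let ?B = "S {1 / 3..1 / 2} \<times> {..<card X}"
  let ?g = "\<lambda>((w, x), y). ((w(y := w x), x), w y)"
  have fin: "finite (S I)" for I
    unfolding S_def using finite_index_maps[OF X] X by (rule_tac finite_subset[of _ "index_maps X pr \<times> X"]) auto
  have dup: "freq X pr (w(y := w x)) x \<in> {1 / 3..1 / 2}"
      "y' \<in> X \<Longrightarrow> y' \<noteq> x \<Longrightarrow> (w(y := w x)) y' = w x \<Longrightarrow> y' = y"
    if "(w, x) \<in> S {1 / 2<..}" "y \<in> X" "y \<noteq> x" for w x y y'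
  proof -
    have x: "x \<in> X" "1 / 2 < freq X pr w x" using that(1) by (simp_all add: S_def)
    note D = freq_duplicate_dominant[OF X pr(1) x that(2,3)]
    show "freq X pr (w(y := w x)) x \<in> {1 / 3..1 / 2}" using D(1,2) by simp
    show "y' = y" if "y' \<in> X" "y' \<noteq> x" "(w(y := w x)) y' = w x"
    proof (rule D(3)[OF that(1,2)])
      have "(w(y := w x)) x = w x" by simp
      then show "(w(y := w x)) y' = (w(y := w x)) x" by (rule trans[OF that(3) sym])
    qed
  qed
  have "card ?A \<le> card ?B"
  proof (rule card_inj_on_le)
    show "inj_on ?g ?A"
    proof (rule inj_onI)
      fix a b assume a: "a \<in> ?A" and b: "b \<in> ?A" and ab: "?g a = ?g b"
      obtain w x y where a': "a = ((w, x), y)" by (metis surj_pair)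
      obtain v x' z where b': "b = ((v, x'), z)" by (metis surj_pair)
      have x: "x' = x" and eq: "w(y := w x) = v(z := v x)" "w y = v z"
        using ab by (auto simp: a' b')
      have wx: "(w, x) \<in> S {1 / 2<..}" "y \<in> X" "y \<noteq> x" and z: "z \<in> X" "z \<noteq> x"
        using a b by (auto simp: a' b' x)
      have "w x = v x" using fun_cong[OF eq(1), of x] wx z by simp
      \<comment> \<open>The common image takes the value \<open>v x = w x\<close> at
        \<open>z\<close>, and by \<open>dup\<close> only \<open>y\<close> can do so; this recovers
        the overwritten point.\<close>
      moreover have "(w(y := w x)) z = v x" unfolding eq(1) by simp
      ultimately have "(w(y := w x)) z = w x" by (simp only:)
      then have "z = y" by (rule dup(2)[OF wx z])
      moreover have "w = v"
      proof
        fix u show "w u = v u"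
          using fun_cong[OF eq(1), of u] eq(2) \<open>z = y\<close> by (cases "u = y") auto
      qed
      ultimately show "a = b" by (simp add: a' b' x)
    qed
    show "?g ` ?A \<subseteq> ?B"
    proof (rule image_subsetI)
      fix a assume a: "a \<in> ?A"
      obtain w x y where a': "a = ((w, x), y)" by (metis surj_pair)
      have wx: "(w, x) \<in> S {1 / 2<..}" and y: "y \<in> X" "y \<noteq> x"
        using a by (auto simp: a')
      have "w \<in> index_maps X pr" "x \<in> X" using wx by (auto simp: S_def)
      then have "w(y := w x) \<in> index_maps X pr" "w y < card X"
        using y pr by (auto simp: index_maps_def PiE_dflt_def)
      then show "?g a \<in> ?B"
        using dup(1)[OF wx y] \<open>x \<in> X\<close> by (simp add: a' S_def)
    qed
    show "finite ?B" using fin by simp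
  qed
  moreover have "card ?A = card (S {1 / 2<..}) * (card X - 1)"
  proof -
    have "card ?A = (\<Sum>p\<in>S {1 / 2<..}. card (case p of (w, x) \<Rightarrow> X - {x}))"
      using fin X by (intro card_SigmaI) auto
    also have "\<dots> = (\<Sum>p\<in>S {1 / 2<..}. card X - 1)"
      by (intro sum.cong) (auto simp: S_def X)
    finally show ?thesis by simp
  qed
  moreover have "card ?B = card (S {1 / 3..1 / 2}) * card X"
    by (simp add: card_cartesian_product)
  ultimately show ?thesis by simp
qed

text \<open>The count loses \<open>card X / (card X - 1) \<le> 4/3\<close>, and frequencies of at
  most 1 are compared with frequencies of at least 1/3. The product of 4/3 and 3 is the constant
  4.\<close>

lemma dominant_weight_le:
  assumes X: "finite X" "4 \<le> card X" and pr: "\<forall>q\<in>set pr. 0 \<le> q" "length pr = card X"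
  defines "P \<equiv> index_maps X pr \<times> X" and "d \<equiv> \<lambda>(w, x). freq X pr w x"
  shows "(\<Sum>p\<in>P. d p * indicator {1 / 2<..} (d p)) \<le> 4 * (\<Sum>p\<in>P. d p * indicator {1 / 3..1 / 2} (d p))"
proof -
  define S where "S I = {p \<in> P. d p \<in> I}" for I
  have S_eq: "S I = {(w, x) \<in> index_maps X pr \<times> X. freq X pr w x \<in> I}" for I
    by (auto simp: S_def P_def d_def)
  have P: "finite P" unfolding P_def using X finite_index_maps by blast
  have d: "0 \<le> d p" "d p \<le> 1" if "p \<in> P" for p
    using that freq_bounds[OF X(1) pr(1)] by (auto simp: P_def d_def)
  have "real (card (S {1 / 2<..})) * (real (card X) - 1) \<le> real (card (S {1 / 3..1 / 2})) * real (card X)"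
  proof -
    have "real (card (S {1 / 2<..}) * (card X - 1)) \<le> real (card (S {1 / 3..1 / 2}) * card X)"
      using card_dominant_le[OF X(1) pr] unfolding S_eq by (rule of_nat_mono)
    then show ?thesis using X by (simp add: of_nat_diff)
  qed
  also have "\<dots> \<le> real (card (S {1 / 3..1 / 2})) * (4 / 3 * (real (card X) - 1))"
    using X by (intro mult_left_mono) auto
  finally have "real (card (S {1 / 2<..})) * (real (card X) - 1) \<le>
      (4 / 3 * real (card (S {1 / 3..1 / 2}))) * (real (card X) - 1)" by (simp only: mult.assoc mult.left_commute)
  then have card: "real (card (S {1 / 2<..})) \<le> 4 / 3 * real (card (S {1 / 3..1 / 2}))"
    by (rule mult_right_le_imp_le) (use X in auto)
  have restrict: "(\<Sum>p\<in>P. d p * indicator I (d p)) = (\<Sum>p\<in>S I. d p)" for I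
    unfolding S_def sum.inter_filter[OF P] by (intro sum.cong) auto
  have "(\<Sum>p\<in>S {1 / 2<..}. d p) \<le> (\<Sum>p\<in>S {1 / 2<..}. 1)"
    using d by (intro sum_mono) (auto simp: S_def)
  also have "\<dots> \<le> (\<Sum>p\<in>S {1 / 3..1 / 2}. 4 * (1 / 3))" using card by simp
  also have "\<dots> \<le> (\<Sum>p\<in>S {1 / 3..1 / 2}. 4 * d p)"
    by (intro sum_mono mult_left_mono) (auto simp: S_def)
  finally show ?thesis by (simp only: restrict sum_distrib_left)
qed

section \<open>The bound on \<open>tau\<close>, by the position of the peak\<close>

theorem theorem5:
  "\<exists>n0 N0 :: nat. \<forall>n\<ge>n0. \<forall>N\<ge>N0. \<forall>(X :: 'a set) (pr :: real list) (x :: 'a) (l :: nat).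
     finite X \<longrightarrow> card X = N \<longrightarrow> prior_list N pr \<longrightarrow> prior_max pr \<le> 1 / 20 \<longrightarrow>
     x \<in> X \<longrightarrow> l \<in> {1..n} \<longrightarrow>
     tau (marginal X pr x) n l \<ge>
       0.4 * ((real l - 1) / (real n - 1)) * (1 / 1.1 ^ l) *
       weight X pr (0.7 * ((real l - 1) / (real n - 1))) (4 / 3 * ((real l - 1) / (real n - 1)))"
proof -
  obtain L where L: "2000 * 2 ^ 19 * 1000 < (11 / 10 :: real) ^ L"
    using real_arch_pow[of "11 / 10"] by auto
  show ?thesis
  \<comment> \<open>If \<open>t > 1/20\<close> then \<open>n - 1 \<le> 20 * m\<close>, so this
    threshold forces \<open>L \<le> Suc m\<close>; the summand 2 also keeps \<open>n - 1\<close>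
    positive. The value 4 for \<open>N\<close> comes from \<open>dominant_weight_le\<close>.\<close>
  proof (rule exI[of _ "20 * L + 2"], rule exI[of _ 4], intro allI impI)
    fix n N :: nat and X :: "'a set" and pr :: "real list" and x :: 'a and l :: nat
    assume n: "20 * L + 2 \<le> n" and N: "4 \<le> N" and X: "finite X" "card X = N"
      and prior: "prior_list N pr" and x: "x \<in> X" and l: "l \<in> {1..n}"
    have pr: "\<forall>q\<in>set pr. 0 \<le> q" "length pr = card X" "pr \<noteq> []"
      using prior X N by (auto simp: prior_list_def)
    define P where "P = index_maps X pr \<times> X"
    define d where "d = (\<lambda>(w, x). freq X pr w x)"
    define m k where "m = l - 1" and "k = n - l"
    define t where "t = (real l - 1) / (real n - 1)"
    define C where "C = real (card (index_maps X pr))"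
    have lm: "l = Suc m" "n - l = k" using l by (auto simp: m_def k_def)
    have t: "t * (real m + real k) = real m" "t \<le> 1"
      using l n by (auto simp: t_def m_def k_def of_nat_diff)
    have P: "finite P" unfolding P_def using X finite_index_maps by blast
    have d: "0 \<le> d p \<and> d p \<le> 1" if "p \<in> P" for p
      using that freq_bounds[OF X(1) pr(1)] by (auto simp: P_def d_def)
    have C: "0 < C"
      unfolding C_def using index_maps_nonempty[OF pr(3)] finite_index_maps[OF X(1)]
      by (simp add: card_gt_0_iff)
    have "sum d P = (\<Sum>w\<in>index_maps X pr. \<Sum>x\<in>X. freq X pr w x)"
      by (simp add: P_def d_def sum.cartesian_product)
    also have "\<dots> \<le> (\<Sum>w\<in>index_maps X pr. 1)"
      by (intro sum_mono sum_freq_le_1)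
    finally have sum: "sum d P \<le> C" by (simp add: C_def)
    have E: "measure_pmf.expectation (marginal X pr x) f = (\<Sum>p\<in>P. f (d p)) / (card X * C)" for f
      using expectation_marginal[OF X(1) pr(3) x, of f]
      by (simp add: P_def d_def C_def case_prod_unfold)
    have tau: "tau (marginal X pr x) n l =
        (\<Sum>p\<in>P. d p * (d p * beta_kernel m k (d p))) / (\<Sum>p\<in>P. d p * beta_kernel m k (d p))"
      unfolding tau_def E using X N C by (simp add: lm(2)) (simp add: lm(1) beta_kernel_def mult_ac)
    define W where "W = weight X pr (7 / 10 * t) (4 / 3 * t)"
    have W: "W = (\<Sum>p\<in>P. d p * indicator {7 / 10 * t..4 / 3 * t} (d p)) / C"
      unfolding W_def weight_def expectation_random_distribution[OF X(1) pr(3)]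
      by (simp add: P_def d_def C_def sum.cartesian_product case_prod_unfold)
    have "2 / 5 * t / (11 / 10) ^ Suc m * W \<le> tau (marginal X pr x) n l"
    proof (cases "m = 0")
      \<comment> \<open>This is \<open>l = 1\<close>: the peak is at 0 and the claimed lower bound
        vanishes.\<close>
      case True
      then have "t = 0" by (simp add: t_def lm)
      moreover have "0 \<le> tau (marginal X pr x) n l"
        unfolding tau using d
        by (intro divide_nonneg_nonneg sum_nonneg mult_nonneg_nonneg beta_kernel_nonneg) auto
      ultimately show ?thesis by simp
    next
      case False
      then have m: "1 \<le> m" by simp
      show ?thesis
      proof (cases "t \<le> 1 / 20")
        case True
        have "0 < t" using m n by (auto simp: t_def lm intro!: divide_pos_pos)
        with True show ?thesis
          unfolding tau by (intro beta_mean_ge_small_peak[OF P d sum C W t(1) _ _ m])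
      next
        case False
        have "real n - 1 \<le> 20 * real m"
          using False n by (auto simp: t_def lm field_simps)
        moreover have "20 * real L + 2 \<le> real n" using n by linarith
        ultimately have "20 * real L \<le> 20 * real m" by linarith
        then have "L \<le> Suc m" by simp
        then have "(11 / 10 :: real) ^ L \<le> (11 / 10) ^ Suc m" by (intro power_increasing) auto
        then have large: "2000 * 2 ^ 19 * 1000 \<le> (11 / 10 :: real) ^ Suc m" using L by linarith
        have half: "(\<Sum>p\<in>P. d p * indicator {1 / 2<..} (d p)) \<le>
            4 * (\<Sum>p\<in>P. d p * indicator {1 / 3..1 / 2} (d p))"
          unfolding P_def d_def using dominant_weight_le[OF X(1) _ pr(1,2)] X N by simp
        show ?thesis
          unfolding tau using False
          by (intro beta_mean_ge_large_peak[OF P d sum C W t(1) _ t(2) m half large]) auto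
      qed
    qed
    then show "0.4 * ((real l - 1) / (real n - 1)) * (1 / 1.1 ^ l) *
        weight X pr (0.7 * ((real l - 1) / (real n - 1))) (4 / 3 * ((real l - 1) / (real n - 1)))
        \<le> tau (marginal X pr x) n l"
      unfolding W_def t_def[symmetric] lm(1)[symmetric] by simp
  qed
qed

end
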